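(* Let $n\ge1$. The periodic points of $s_{132}:S_n\to S_n$ are precisely the permutations in $S_n$ avoiding $132$ and $231$ classically, and the periodic points of $s_{312}:S_n\to S_n$ are precisely the permutations in $S_n$ avoiding $213$ and $312$ classically. When $n\ge2$, each of these periodic points has period $2$. Furthermore, for every $\pi\in S_n$, $s_{132}^{n-1}(\pi)$ avoids $132$ and $231$, and $s_{312}^{n-1}(\pi)$ avoids $213$ and $312$.
   Context: $S_n$ is the set of permutations of $[n]$ in one-line notation. Two sequences of distinct integers have the same relative order if replacing the $i$th smallest entry of each by $i$ yields the same word; a sequence contains $\sigma$ classically if some (not necessarily consecutive) subsequence has the same relative order as $\sigma$, and avoids it otherwise. For $\sigma\in\{132,312\}$, $s_\sigma:S_n\to S_n$ sends a permutation through a stack: at each step, if there is a next input entry and placing it on top of the stack would make the stack contents, read top to bottom, avoid $\sigma$ classically, push it; otherwise pop the top entry of the stack to the end of the output; stop when the output has length $n$. A periodic point of $f:S_n\to S_n$ is $\pi$ with $f^t(\pi)=\pi$ for some $t\ge1$; its period is the least such $t$; $f^0$ is the identity. *)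

theory Defs
  imports "HOL-Library.Sublist" "HOL-Combinatorics.Multiset_Permutations"
begin

abbreviation Perms :: "nat \<Rightarrow> nat list set" where
  "Perms n \<equiv> permutations_of_set {1..n}"

text \<open>For a list of distinct numbers, the \<open>i\<close>th smallest entry is replaced by \<open>i\<close>.\<close>

definition standardize :: "nat list \<Rightarrow> nat list" where
  "standardize xs = map (\<lambda>x. card {y \<in> set xs. y \<le> x}) xs"

definition same_relative_order :: "nat list \<Rightarrow> nat list \<Rightarrow> bool" where
  "same_relative_order xs ys \<longleftrightarrow> standardize xs = standardize ys"

definition contains_pattern :: "nat list \<Rightarrow> nat list \<Rightarrow> bool" where
  "contains_pattern xs \<sigma> \<longleftrightarrow> (\<exists>ys. subseq ys xs \<and> same_relative_order ys \<sigma>)"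

definition avoids_pattern :: "nat list \<Rightarrow> nat list \<Rightarrow> bool" where
  "avoids_pattern xs \<sigma> \<longleftrightarrow> \<not> contains_pattern xs \<sigma>"

text \<open>
  The arguments are the pattern, the remaining input, the stack read from top to bottom, and the
  output so far. The output has reached full length exactly when input and stack are both empty.
  With an empty stack and an entry that may not be pushed, no move is possible; this
  branch only serves totality, as it is unreachable for patterns of length at least 2.
\<close>

function stack_run :: "nat list \<Rightarrow> nat list \<Rightarrow> nat list \<Rightarrow> nat list \<Rightarrow> nat list" where
  "stack_run \<sigma> (x # inp) (y # st) out =
     (if avoids_pattern (x # y # st) \<sigma> then stack_run \<sigma> inp (x # y # st) out
      else stack_run \<sigma> (x # inp) st (out @ [y]))"
| "stack_run \<sigma> (x # inp) [] out =
     (if avoids_pattern [x] \<sigma> then stack_run \<sigma> inp [x] out else out)"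
| "stack_run \<sigma> [] (y # st) out = stack_run \<sigma> [] st (out @ [y])"
| "stack_run \<sigma> [] [] out = out"
  by pat_completeness auto
termination
  by (relation "measure (\<lambda>(\<sigma>, inp, st, out). 2 * length inp + length st)") auto

definition stack_map :: "nat list \<Rightarrow> nat list \<Rightarrow> nat list" where
  "stack_map \<sigma> \<pi> = stack_run \<sigma> \<pi> [] []"

definition periodic_point :: "('a \<Rightarrow> 'a) \<Rightarrow> 'a \<Rightarrow> bool" where
  "periodic_point f x \<longleftrightarrow> (\<exists>t\<ge>1. (f ^^ t) x = x)"

definition period :: "('a \<Rightarrow> 'a) \<Rightarrow> 'a \<Rightarrow> nat" where
  "period f x = (LEAST t. t \<ge> 1 \<and> (f ^^ t) x = x)"

lemma avoids_pattern_singleton: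
  assumes "length \<sigma> \<ge> 2"
  shows "avoids_pattern [x] \<sigma>"
proof -
  have False if "subseq ys [x]" "standardize ys = standardize \<sigma>" for ys
  proof -
    have "length ys \<le> 1" using list_emb_length[OF that(1)] by simp
    moreover have "length ys = length \<sigma>"
      using arg_cong[OF that(2), of length] by (simp add: standardize_def)
    ultimately show False using assms by linarith
  qed
  then show ?thesis
    unfolding avoids_pattern_def contains_pattern_def same_relative_order_def by blast
qed

lemma mset_stack_run:
  "length \<sigma> \<ge> 2 \<Longrightarrow> mset (stack_run \<sigma> inp st out) = mset inp + mset st + mset out"
  by (induction \<sigma> inp st out rule: stack_run.induct) (simp_all add: avoids_pattern_singleton)

lemma stack_map_in_Perms:
  assumes "length \<sigma> \<ge> 2" and "\<pi> \<in> Perms n"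
  shows "stack_map \<sigma> \<pi> \<in> Perms n"
proof -
  have m: "mset (stack_map \<sigma> \<pi>) = mset \<pi>"
    using mset_stack_run[OF assms(1)] by (simp add: stack_map_def)
  from assms(2) show ?thesis
    using mset_eq_setD[OF m] mset_eq_imp_distinct_iff[OF m]
    by (simp add: permutations_of_set_def)
qed

end

theory Submission
  imports Defs
begin

text \<open>
  Consider 132; complementing values turns it into 312. A permutation avoids 132 and 231 iff it is
  a valley, i.e. decreasing and then increasing. A valley goes entirely onto the stack, so the map
  reverses it, and the reverse is again a valley. For an arbitrary permutation \<open>A @ D @ E @ F\<close> with
  \<open>D\<close> decreasing, \<open>E @ F\<close> increasing and all of \<open>D @ E\<close> below all of \<open>A\<close>, let \<open>m\<close> be the minimum of
  \<open>A\<close>. Pushing \<open>m\<close> forces the stack \<open>I\<close> under it to be increasing; then \<open>m\<close> is never popped before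
  the input ends, while the first entry after \<open>A\<close> expels everything above \<open>m\<close>. The rest of the
  input is pushed without any pop, so the output ends in \<open>rev F @ rev E @ rev D @ m # I\<close>. Hence each
  pass adds at least one element to the low valley \<open>D @ E\<close>, and \<open>n - 1\<close> passes suffice.
\<close>

section \<open>Three-letter patterns as order conditions\<close>

lemma standardize_eq_132_iff:
  "standardize ys = standardize [1,3,2] \<longleftrightarrow> (\<exists>a b c. ys = [a,b,c] \<and> a < c \<and> c < b)"
  and standardize_eq_231_iff:
  "standardize ys = standardize [2,3,1] \<longleftrightarrow> (\<exists>a b c. ys = [a,b,c] \<and> c < a \<and> a < b)"
  and standardize_eq_312_iff:
  "standardize ys = standardize [3,1,2] \<longleftrightarrow> (\<exists>a b c. ys = [a,b,c] \<and> b < c \<and> c < a)"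
  and standardize_eq_213_iff:
  "standardize ys = standardize [2,1,3] \<longleftrightarrow> (\<exists>a b c. ys = [a,b,c] \<and> b < a \<and> a < c)"
proof -
  \<comment> \<open>These rules evaluate the rank sets in \<open>standardize\<close> one element at
    a time, as the comparisons between entries become known.\<close>
  have filter_insert: "{y. (y = a \<or> Q y) \<and> P y} = (if P a then insert a {y. Q y \<and> P y} else {y. Q y \<and> P y})"
    and filter_single: "{y. y = a \<and> P y} = (if P a then {a} else {})" for a :: nat and P Q
    by auto
  \<comment> \<open>\<open>standardize\<close> keeps the length, so a value of length three forces
    exactly three entries.\<close>
  have triple: "standardize ys = [p,q,r] \<longleftrightarrow> (\<exists>a b c. ys = [a,b,c] \<and> standardize [a,b,c] = [p,q,r])"
    for p q r
    by (auto simp: standardize_def map_eq_Cons_conv)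
  note calc = standardize_def filter_insert filter_single card_insert_if
  have value_132: "standardize [1,3,2] = [1,3,2]" by (simp add: calc)
  have value_231: "standardize [2,3,1] = [2,3,1]" by (simp add: calc)
  have value_312: "standardize [3,1,2] = [3,1,2]" by (simp add: calc)
  have value_213: "standardize [2,1,3] = [2,1,3]" by (simp add: calc)
  have t1: "standardize [a,b,c] = [1,3,2] \<longleftrightarrow> a < c \<and> c < b" for a b c
    by (cases a b rule: linorder_cases; cases a c rule: linorder_cases; cases b c rule: linorder_cases)
      (simp_all add: calc)
  have t2: "standardize [a,b,c] = [2,3,1] \<longleftrightarrow> c < a \<and> a < b" for a b c
    by (cases a b rule: linorder_cases; cases a c rule: linorder_cases; cases b c rule: linorder_cases)
      (simp_all add: calc)
  have t3: "standardize [a,b,c] = [3,1,2] \<longleftrightarrow> b < c \<and> c < a" for a b c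
    by (cases a b rule: linorder_cases; cases a c rule: linorder_cases; cases b c rule: linorder_cases)
      (simp_all add: calc)
  have t4: "standardize [a,b,c] = [2,1,3] \<longleftrightarrow> b < a \<and> a < c" for a b c
    by (cases a b rule: linorder_cases; cases a c rule: linorder_cases; cases b c rule: linorder_cases)
      (simp_all add: calc)
  show "standardize ys = standardize [1,3,2] \<longleftrightarrow> (\<exists>a b c. ys = [a,b,c] \<and> a < c \<and> c < b)"
    unfolding value_132 triple t1 ..
  show "standardize ys = standardize [2,3,1] \<longleftrightarrow> (\<exists>a b c. ys = [a,b,c] \<and> c < a \<and> a < b)"
    unfolding value_231 triple t2 ..
  show "standardize ys = standardize [3,1,2] \<longleftrightarrow> (\<exists>a b c. ys = [a,b,c] \<and> b < c \<and> c < a)"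
    unfolding value_312 triple t3 ..
  show "standardize ys = standardize [2,1,3] \<longleftrightarrow> (\<exists>a b c. ys = [a,b,c] \<and> b < a \<and> a < c)"
    unfolding value_213 triple t4 ..
qed

text \<open>Brings sortedness into the language of pattern avoidance: both then quantify over
  subsequences.\<close>

lemma sorted_wrt_iff_subseq:
  "sorted_wrt R xs \<longleftrightarrow> (\<forall>y z. subseq [y,z] xs \<longrightarrow> R y z)"
proof (induction xs)
  case (Cons x xs)
  have "subseq [y,z] (x # xs) \<longleftrightarrow> (y = x \<and> z \<in> set xs) \<or> subseq [y,z] xs" for y z
    by (auto simp: subseq_singleton_left dest: subseq_Cons')
  then show ?case using Cons by auto
qed auto

lemma sorted_wrt_subseqD: "sorted_wrt R xs \<Longrightarrow> subseq [y,z] xs \<Longrightarrow> R y z"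
  using sorted_wrt_iff_subseq[of R xs] by simp

lemma distinct_subseq_pair: "subseq [y,z] xs \<Longrightarrow> distinct xs \<Longrightarrow> y \<noteq> z"
  by (induction xs) (auto simp: subseq_singleton_left split: if_splits)

lemma stack_run_no_input: "stack_run \<sigma> [] st out = out @ st"
  by (induction st arbitrary: out) auto

text \<open>
  The locale treats both maps at once: \<open>lt\<close> is \<open><\<close> for the pattern 132 and \<open>>\<close> for 312, and
  \<open>\<tau>\<close> is the other pattern of length three (231 or 213) whose middle entry is its \<open>lt\<close>-maximum.
\<close>

locale peak_pattern_stack =
  fixes lt :: "nat \<Rightarrow> nat \<Rightarrow> bool" (infix \<open>\<sqsubset>\<close> 50) and \<sigma> \<tau> :: "nat list"
  assumes irrefl: "\<not> x \<sqsubset> x"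
    and trans: "x \<sqsubset> y \<Longrightarrow> y \<sqsubset> z \<Longrightarrow> x \<sqsubset> z"
    and total: "x \<noteq> y \<Longrightarrow> x \<sqsubset> y \<or> y \<sqsubset> x"
    and length_pattern: "length \<sigma> \<ge> 2"
    and avoids_\<sigma>_iff: "avoids_pattern xs \<sigma> \<longleftrightarrow> (\<forall>a b c. subseq [a,b,c] xs \<longrightarrow> \<not> (a \<sqsubset> c \<and> c \<sqsubset> b))"
    and avoids_\<tau>_iff: "avoids_pattern xs \<tau> \<longleftrightarrow> (\<forall>a b c. subseq [a,b,c] xs \<longrightarrow> \<not> (c \<sqsubset> a \<and> a \<sqsubset> b))"
begin

abbreviation increasing :: "nat list \<Rightarrow> bool" where
  "increasing \<equiv> sorted_wrt (\<sqsubset>)"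

abbreviation decreasing :: "nat list \<Rightarrow> bool" where
  "decreasing \<equiv> sorted_wrt (\<lambda>x y. y \<sqsubset> x)"

section \<open>Valleys and pattern avoidance\<close>

text \<open>Nothing is required where \<open>D\<close> meets \<open>E\<close>: either comparison of
  the two entries there leaves a single bottom.\<close>

definition valley :: "nat list \<Rightarrow> bool" where
  "valley xs \<longleftrightarrow> (\<exists>D E. xs = D @ E \<and> decreasing D \<and> increasing E)"

lemma valleyI: "decreasing D \<Longrightarrow> increasing E \<Longrightarrow> valley (D @ E)"
  unfolding valley_def by blast

text \<open>An entry \<open>b\<close> above an earlier entry cannot lie in \<open>D\<close>, so
  \<open>b\<close> and \<open>c\<close> both come from the increasing \<open>E\<close>.\<close>

lemma valley_subseq:
  assumes "decreasing D" "increasing E" "subseq [a,b,c] (D @ E)" "a \<sqsubset> b"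
  shows "b \<sqsubset> c"
proof -
  \<comment> \<open>The bound \<open>t\<close> stands for the entry of \<open>D\<close> chosen as
    \<open>a\<close>: the rest of \<open>D\<close> is below it, while \<open>b\<close> is above
    it.\<close>
  have tail: "subseq [b,c] E"
    if "\<forall>d \<in> set D. d \<sqsubset> t" "t \<sqsubset> b" "subseq [b,c] (D @ E)" for D t
    using that
  proof (induction D)
    case (Cons d D)
    then have "b \<noteq> d" using irrefl trans by (metis list.set_intros(1))
    then show ?case using Cons by simp
  qed simp
  show ?thesis
    using assms
  proof (induction D)
    case Nil
    then have "subseq [b,c] E" using subseq_Cons'[of a "[b,c]" E] by simp
    then show ?case using Nil.prems(2) by (rule sorted_wrt_subseqD[rotated])
  next
    case (Cons t D)
    show ?case
    proof (cases "subseq [a,b,c] (D @ E)")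
      case True
      then show ?thesis using Cons by auto
    next
      case False
      then have "a = t" "subseq [b,c] (D @ E)"
        using Cons.prems(3) by (auto split: if_splits)
      then have "subseq [b,c] E"
        using tail Cons.prems by auto
      then show ?thesis using Cons.prems(2) by (rule sorted_wrt_subseqD[rotated])
    qed
  qed
qed

text \<open>Both patterns rise to their middle entry and then drop, which
  \<open>valley_subseq\<close> rules out.\<close>

lemma valley_avoids:
  assumes "valley xs"
  shows "avoids_pattern xs \<sigma>" "avoids_pattern xs \<tau>"
proof -
  obtain D E where "xs = D @ E" "decreasing D" "increasing E"
    using assms valley_def by blast
  then have *: "b \<sqsubset> c" if "subseq [a,b,c] xs" "a \<sqsubset> b" for a b c
    using valley_subseq that by blast
  show "avoids_pattern xs \<sigma>" unfolding avoids_\<sigma>_iff using * trans irrefl by metis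
  show "avoids_pattern xs \<tau>" unfolding avoids_\<tau>_iff using * trans irrefl by metis
qed

text \<open>For distinct entries with \<open>a \<sqsubset> b\<close>, the two patterns are the only
  ways for a later \<open>c\<close> to lie below \<open>b\<close>; avoiding both forces
  \<open>b \<sqsubset> c\<close>. Tails inherit this condition, so it drives the induction.\<close>

lemma valley_if_avoids:
  assumes "distinct xs" "avoids_pattern xs \<sigma>" "avoids_pattern xs \<tau>"
  shows "valley xs"
proof -
  have "b \<sqsubset> c" if s: "subseq [a,b,c] xs" "a \<sqsubset> b" for a b c
  proof -
    have "subseq [b,c] xs" using s(1) by (rule subseq_Cons')
    then have "b \<noteq> c" using assms(1) by (rule distinct_subseq_pair)
    moreover have "subseq [a,c] [a,b,c]" by simp
    then have "subseq [a,c] xs" using s(1) by (rule subseq_order.trans)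
    then have "a \<noteq> c" using assms(1) by (rule distinct_subseq_pair)
    ultimately show ?thesis
      using assms(2,3) s total[of b c] total[of a c] unfolding avoids_\<sigma>_iff avoids_\<tau>_iff by blast
  qed
  with assms(1) show ?thesis
  proof (induction xs)
    case Nil
    then show ?case using valleyI[of "[]" "[]"] by simp
  next
    case (Cons x xs)
    have "valley xs"
    proof (rule Cons.IH)
      show "distinct xs" using Cons.prems(1) by simp
      show "b \<sqsubset> c" if "subseq [a,b,c] xs" "a \<sqsubset> b" for a b c
        using Cons.prems(2)[OF list_emb_Cons[OF that(1)] that(2)] .
    qed
    then obtain D E where DE: "xs = D @ E" "decreasing D" "increasing E"
      using valley_def by blast
    show ?case
    proof (cases xs)
      case Nil
      then show ?thesis using valleyI[of "[]" "[x]"] by simp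
    next
      case (Cons y ys)
      consider "x \<sqsubset> y" | "y \<sqsubset> x"
        using total[of x y] Cons.prems(1) Cons by auto
      then show ?thesis
      proof cases
        \<comment> \<open>After this ascent everything behind \<open>y\<close> is above
          \<open>y\<close>, so \<open>D\<close> holds at most \<open>y\<close> and the tail is
          already increasing.\<close>
        case 1
        have y: "y \<sqsubset> c" if "c \<in> set ys" for c
        proof -
          have "subseq [x,y,c] (x # xs)" using that Cons by (simp add: subseq_singleton_left)
          then show ?thesis using 1 by (rule Cons.prems(2))
        qed
        have "increasing xs"
        proof (cases D)
          case Nil
          then show ?thesis using DE by simp
        next
          case (Cons d D')
          then have "d = y" "ys = D' @ E" using DE \<open>xs = y # ys\<close> by auto
          moreover from this have "D' = []"
          proof -
            have "d \<sqsubset> d" if "z \<in> set D'" for z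
              using that DE(2) Cons y \<open>d = y\<close> \<open>ys = D' @ E\<close> trans[of d z d] by simp
            then show ?thesis using irrefl by (cases D') auto
          qed
          ultimately show ?thesis using DE y \<open>xs = y # ys\<close> by simp
        qed
        moreover have "x \<sqsubset> z" if "z \<in> set xs" for z
          using that 1 y[of z] Cons trans[of x y z] by auto
        ultimately have "increasing (x # xs)" by simp
        then show ?thesis using valleyI[of "[]"] by simp
      next
        case 2
        have "valley ((x # D) @ E)" if nonempty: "D \<noteq> []"
        proof (rule valleyI)
          show "decreasing (x # D)"
          proof -
            obtain D' where D': "D = y # D'" using nonempty DE Cons by (cases D) auto
            then have "d \<sqsubset> x" if "d \<in> set D" for d
              using that 2 DE(2) trans[of d y x] by auto
            then show ?thesis using DE by simp
          qed
        qed (use DE in simp)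
        \<comment> \<open>With \<open>D\<close> empty, \<open>y\<close> heads \<open>E\<close>, and
          \<open>x\<close> alone becomes the decreasing part.\<close>
        moreover have "valley ([x] @ E)"
          using valleyI[of "[x]" E] DE by simp
        ultimately show ?thesis using DE by (cases D) auto
      qed
    qed
  qed
qed

lemma valley_rev:
  assumes "valley xs"
  shows "valley (rev xs)"
proof -
  obtain D E where "xs = D @ E" "decreasing D" "increasing E"
    using assms valley_def by blast
  then show ?thesis using valleyI[of "rev E" "rev D"] by (simp add: sorted_wrt_rev)
qed

section \<open>Runs of the stack\<close>

lemma avoids_push_on_increasing: "increasing st \<Longrightarrow> avoids_pattern (x # st) \<sigma>"
  using valley_avoids(1)[OF valleyI[of "[x]" st]] by simp

lemma stack_run_push:
  "avoids_pattern (x # st) \<sigma> \<Longrightarrow> stack_run \<sigma> (x # X) st out = stack_run \<sigma> X (x # st) out"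
  by (cases st) auto

lemma stack_run_pop:
  "\<not> avoids_pattern (x # y # st) \<sigma> \<Longrightarrow>
    stack_run \<sigma> (x # X) (y # st) out = stack_run \<sigma> (x # X) st (out @ [y])"
  by auto

text \<open>Bookkeeping for the entries before the minimum \<open>m\<close>: only which entries are
  on the stack or in the output matters later, not their arrangement.\<close>

lemma stack_run_consume:
  "\<exists>st' out'. stack_run \<sigma> (L @ X) st out = stack_run \<sigma> X st' out' \<and>
     mset st' + mset out' = mset L + mset st + mset out"
proof (induction L arbitrary: st out)
  case (Cons x L)
  note outer = Cons.IH
  \<comment> \<open>A pop shortens the stack and leaves the input alone, so the pops before
    \<open>x\<close> is pushed call for an inner induction on the stack.\<close>
  show ?case
  proof (induction st arbitrary: out)
    case Nil
    have "stack_run \<sigma> ((x # L) @ X) [] out = stack_run \<sigma> (L @ X) [x] out"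
      by (simp add: avoids_pattern_singleton length_pattern)
    then show ?case using outer[of "[x]" out] by simp
  next
    case (Cons y st)
    show ?case
    proof (cases "avoids_pattern (x # y # st) \<sigma>")
      case True
      then show ?thesis
        using outer[of "x # y # st" out]
        by (simp add: stack_run_push add_mset_commute)
    next
      case False
      then show ?thesis using Cons[of "out @ [y]"] by simp
    qed
  qed
qed auto

text \<open>As \<open>m\<close> is below the whole stack, any descent there would form the pattern
  with \<open>m\<close> on top. Pops therefore continue until the remaining stack is
  increasing.\<close>

lemma stack_run_push_min:
  assumes "distinct st" "\<forall>y \<in> set st. m \<sqsubset> y"
  shows "\<exists>T I. st = T @ I \<and> increasing I \<and>
           stack_run \<sigma> (m # X) st out = stack_run \<sigma> X (m # I) (out @ T)"
  using assms
proof (induction st arbitrary: out)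
  case Nil
  then show ?case by (simp add: avoids_pattern_singleton length_pattern)
next
  case (Cons y st)
  show ?case
  proof (cases "avoids_pattern (m # y # st) \<sigma>")
    case True
    have "increasing (y # st)"
      unfolding sorted_wrt_iff_subseq
    proof (intro allI impI)
      fix b c assume s: "subseq [b,c] (y # st)"
      then have "subseq [m,b,c] (m # y # st)" by simp
      then have "\<not> (m \<sqsubset> c \<and> c \<sqsubset> b)" using True avoids_\<sigma>_iff by blast
      moreover have "m \<sqsubset> c"
        using subseq_Cons'[OF s] Cons.prems(2) by (auto simp: subseq_singleton_left simp del: subseq_Cons2_iff)
      moreover have "b \<noteq> c" using distinct_subseq_pair[OF s Cons.prems(1)] .
      ultimately show "b \<sqsubset> c" using total by blast
    qed
    then show ?thesis using True by (intro exI[of _ "[]"] exI[of _ "y # st"]) simp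
  next
    case False
    obtain T I where "st = T @ I" "increasing I"
      "stack_run \<sigma> (m # X) st (out @ [y]) = stack_run \<sigma> X (m # I) ((out @ [y]) @ T)"
      using Cons.IH[of "out @ [y]"] Cons.prems by auto
    then show ?thesis using False by (intro exI[of _ "y # T"] exI[of _ I]) simp
  qed
qed

text \<open>
  A push directly onto an increasing stack never creates the pattern, so \<open>m\<close> stays until the input
  is exhausted.
\<close>

lemma stack_run_above_min:
  assumes "increasing (m # I)"
  shows "\<exists>T' out'. stack_run \<sigma> (M @ X) (T @ m # I) out = stack_run \<sigma> X (T' @ m # I) out' \<and>
           mset T' + mset out' = mset M + mset T + mset out"
proof (induction M arbitrary: T out)
  case (Cons x M)
  note outer = Cons.IH
  show ?case
  proof (induction T arbitrary: out)
    case Nil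
    have "stack_run \<sigma> ((x # M) @ X) (m # I) out = stack_run \<sigma> (M @ X) ([x] @ m # I) out"
      using stack_run_push[OF avoids_push_on_increasing[OF assms]] by simp
    then show ?case using outer[of "[x]" out] by simp
  next
    case (Cons y T)
    show ?case
    proof (cases "avoids_pattern (x # y # T @ m # I) \<sigma>")
      case True
      then show ?thesis using outer[of "x # y # T" out] by (simp add: add_mset_commute)
    next
      case False
      then show ?thesis using Cons[of "out @ [y]"] by simp
    qed
  qed
qed auto

text \<open>An entry \<open>x\<close> below \<open>m\<close> cannot be placed on a \<open>t\<close>
  above \<open>m\<close> while \<open>m\<close> lies deeper, because \<open>x\<close>,
  \<open>t\<close>, \<open>m\<close> form the pattern. Without input the stack is emptied in order,
  and both sides agree.\<close>

lemma stack_run_uncover_min: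
  assumes "\<forall>t \<in> set T. m \<sqsubset> t" "X \<noteq> [] \<Longrightarrow> hd X \<sqsubset> m"
  shows "stack_run \<sigma> X (T @ m # I) out = stack_run \<sigma> X (m # I) (out @ T)"
proof (cases X)
  case Nil
  then show ?thesis by (simp add: stack_run_no_input)
next
  case (Cons x X')
  have "\<not> avoids_pattern (x # t # T @ m # I) \<sigma>" if "m \<sqsubset> t" for t T
  proof -
    have "subseq [x,t,m] (x # t # T @ m # I)" by (simp add: subseq_singleton_left)
    then show ?thesis using that assms(2) Cons avoids_\<sigma>_iff by fastforce
  qed
  with assms(1) Cons show ?thesis
    by (induction T arbitrary: out) (simp_all add: stack_run_pop)
qed

text \<open>The stack, read from the top, stays a valley throughout, so every push is allowed and
  nothing leaves before the input ends.\<close>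

lemma stack_run_valley:
  assumes "decreasing D" "increasing E" "increasing st" "\<forall>d \<in> set D. \<forall>y \<in> set st. d \<sqsubset> y"
  shows "stack_run \<sigma> (D @ E) st out = out @ rev E @ rev D @ st"
proof -
  \<comment> \<open>\<open>T\<close> holds the entries pushed so far, newest first;
    \<open>rev E @ T\<close> is the upper part of the stack once all of \<open>E\<close> is
    pushed.\<close>
  have push_E: "stack_run \<sigma> E (T @ st) out = out @ rev E @ T @ st"
    if "decreasing (rev E @ T)" "increasing st" for E T st
    using that
  proof (induction E arbitrary: T)
    case (Cons x E)
    have "valley ((x # T) @ st)" using Cons.prems by (intro valleyI) (auto simp: sorted_wrt_append)
    then have "stack_run \<sigma> (x # E) (T @ st) out = stack_run \<sigma> E ((x # T) @ st) out"
      using valley_avoids(1) stack_run_push by fastforce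
    then show ?case using Cons.IH[of "x # T"] Cons.prems by simp
  qed (simp add: stack_run_no_input)
  have push_D: "stack_run \<sigma> (D @ E) st out = stack_run \<sigma> E (rev D @ st) out"
    using assms(1,3,4)
  proof (induction D arbitrary: st)
    case (Cons x D)
    have "stack_run \<sigma> ((x # D) @ E) st out = stack_run \<sigma> (D @ E) (x # st) out"
      using stack_run_push[OF avoids_push_on_increasing] Cons.prems by simp
    then show ?case using Cons.IH[of "x # st"] Cons.prems by auto
  qed simp
  have "increasing (rev D @ st)"
    using assms by (auto simp: sorted_wrt_append sorted_wrt_rev)
  then show ?thesis
    using push_D push_E[of E "[]" "rev D @ st"] assms(2) by (simp add: sorted_wrt_rev)
qed

lemma stack_map_valley: "valley xs \<Longrightarrow> stack_map \<sigma> xs = rev xs"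
  unfolding valley_def stack_map_def using stack_run_valley[where st = "[]" and out = "[]"] by auto

section \<open>Growth of the low valley under one pass\<close>

text \<open>
  The last condition guarantees that the first entry after \<open>A\<close> lies below all of \<open>A\<close>, so that it
  uncovers the minimum of \<open>A\<close> on the stack.
\<close>

definition valley_below :: "nat \<Rightarrow> nat list \<Rightarrow> bool" where
  "valley_below k xs \<longleftrightarrow> (\<exists>A D E F. xs = A @ D @ E @ F \<and> decreasing D \<and> increasing (E @ F) \<and>
     (\<forall>x \<in> set (D @ E). \<forall>a \<in> set A. x \<sqsubset> a) \<and> k \<le> length (D @ E) \<and> (D @ E = [] \<longrightarrow> F = []))"

lemma valley_below_0: "valley_below 0 xs"
  unfolding valley_below_def by (rule exI[of _ xs]) auto

text \<open>At most one entry is left in \<open>A\<close>; being above all of \<open>D\<close>, it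
  extends \<open>D\<close> at the front.\<close>

lemma valley_if_valley_below:
  assumes "valley_below k xs" "length xs \<le> Suc k"
  shows "valley xs"
proof -
  obtain A D E F where xs: "xs = A @ D @ E @ F" "decreasing D" "increasing (E @ F)"
    "\<forall>x \<in> set (D @ E). \<forall>a \<in> set A. x \<sqsubset> a" "k \<le> length (D @ E)"
    using assms(1) valley_below_def by auto
  then have "length A \<le> 1" using assms(2) by simp
  then have "decreasing (A @ D)"
    using xs by (cases A) (auto simp: sorted_wrt_append)
  then show ?thesis using valleyI[of "A @ D" "E @ F"] xs by simp
qed

lemma minimum_split:
  assumes "distinct A" "A \<noteq> []"
  shows "\<exists>L m M. A = L @ m # M \<and> (\<forall>x \<in> set (L @ M). m \<sqsubset> x)"
proof -
  have "\<exists>m \<in> set A. \<forall>x \<in> set A. x \<noteq> m \<longrightarrow> m \<sqsubset> x"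
    using assms(2)
  proof (induction A rule: list_nonempty_induct)
    case (cons x xs)
    then obtain m where "m \<in> set xs" "\<forall>y \<in> set xs. y \<noteq> m \<longrightarrow> m \<sqsubset> y" by blast
    then show ?case using total trans irrefl by (metis set_ConsD list.set_intros)
  qed simp
  then obtain m where "m \<in> set A" and m: "\<forall>x \<in> set A. x \<noteq> m \<longrightarrow> m \<sqsubset> x" by blast
  then obtain L M where "A = L @ m # M" by (meson split_list)
  then show ?thesis using m assms(1) by (intro exI[of _ L] exI[of _ m] exI[of _ M]) auto
qed

lemma increasing_split_at:
  assumes "increasing F"
  shows "\<exists>F1 F2. F = F1 @ F2 \<and> (\<forall>x \<in> set F1. x \<sqsubset> m) \<and> (\<forall>x \<in> set F2. \<not> x \<sqsubset> m)"
  using assms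
proof (induction F)
  case (Cons x F)
  show ?case
  proof (cases "x \<sqsubset> m")
    case True
    obtain F1 F2 where "F = F1 @ F2" "\<forall>x \<in> set F1. x \<sqsubset> m" "\<forall>x \<in> set F2. \<not> x \<sqsubset> m"
      using Cons by auto
    then show ?thesis using True by (intro exI[of _ "x # F1"] exI[of _ F2]) auto
  next
    case False
    then have "\<not> z \<sqsubset> m" if "z \<in> set (x # F)" for z
      using that Cons.prems trans[of x z m] by auto
    then show ?thesis by (intro exI[of _ "[]"] exI[of _ "x # F"]) auto
  qed
qed auto

lemma valley_below_stack_map:
  assumes "distinct xs" "valley_below k xs" "\<not> valley xs"
  shows "valley_below (Suc k) (stack_map \<sigma> xs)"
proof -
  obtain A D E F where xs: "xs = A @ D @ E @ F" and D: "decreasing D" and EF: "increasing (E @ F)"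
    and below: "\<forall>x \<in> set (D @ E). \<forall>a \<in> set A. x \<sqsubset> a" and k: "k \<le> length (D @ E)"
    and F: "D @ E = [] \<longrightarrow> F = []"
    using assms(2) valley_below_def by auto
  let ?X = "D @ E @ F"
  \<comment> \<open>With \<open>A\<close> empty, \<open>xs\<close> would be a valley; so
    \<open>A\<close> has a minimum \<open>m\<close>.\<close>
  have "A \<noteq> []" using assms(3) valleyI[OF D EF] xs by auto
  then obtain L m M where A: "A = L @ m # M" and m: "\<forall>x \<in> set (L @ M). m \<sqsubset> x"
    using minimum_split[of A] assms(1) xs by auto
  obtain st1 out1 where 1: "stack_run \<sigma> (L @ m # M @ ?X) [] [] = stack_run \<sigma> (m # M @ ?X) st1 out1"
    and ms1: "mset st1 + mset out1 = mset L"
    using stack_run_consume[of L "m # M @ ?X" "[]" "[]"] by auto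
  have set1: "set st1 \<union> set out1 = set L"
    using arg_cong[OF ms1, of set_mset] by simp
  have "mset (st1 @ out1) = mset L" using ms1 by simp
  then have "distinct (st1 @ out1)"
    using assms(1) xs A mset_eq_imp_distinct_iff distinct_append by metis
  then have "distinct st1" by simp
  moreover have "\<forall>y \<in> set st1. m \<sqsubset> y" using set1 m by auto
  ultimately obtain T1 I where st1: "st1 = T1 @ I" and I: "increasing I"
    and 2: "stack_run \<sigma> (m # M @ ?X) st1 out1 = stack_run \<sigma> (M @ ?X) (m # I) (out1 @ T1)"
    using stack_run_push_min by blast
  have mI: "increasing (m # I)" using I st1 set1 m by auto
  obtain T out2 where
    3: "stack_run \<sigma> (M @ ?X) (m # I) (out1 @ T1) = stack_run \<sigma> ?X (T @ m # I) out2"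
    and ms2: "mset T + mset out2 = mset M + mset (out1 @ T1)"
    using stack_run_above_min[OF mI, of M ?X "[]" "out1 @ T1"] by auto
  have "set T \<union> set out2 = set M \<union> set out1 \<union> set T1"
    using arg_cong[OF ms2, of set_mset] by auto
  then have out2: "\<forall>x \<in> set (out2 @ T). m \<sqsubset> x" using m st1 set1 by auto
  have "hd ?X \<sqsubset> m" if "?X \<noteq> []"
  proof -
    have "hd ?X \<in> set (D @ E)" using that F by (cases D; cases E) auto
    then show ?thesis using below A by simp
  qed
  then have 4: "stack_run \<sigma> ?X (T @ m # I) out2 = stack_run \<sigma> ?X (m # I) (out2 @ T)"
    using out2 by (intro stack_run_uncover_min) auto
  have DmI: "\<forall>d \<in> set D. \<forall>y \<in> set (m # I). d \<sqsubset> y"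
  proof (intro ballI)
    fix d y assume "d \<in> set D" "y \<in> set (m # I)"
    then have "d \<sqsubset> m" "y = m \<or> m \<sqsubset> y" using below A mI by auto
    then show "d \<sqsubset> y" using trans by blast
  qed
  \<comment> \<open>\<open>F\<close> is cut at the level of \<open>m\<close>: \<open>F1\<close> will
    join the new low valley, and \<open>F2\<close> the new high prefix.\<close>
  obtain F1 F2 where split: "F = F1 @ F2" "\<forall>x \<in> set F1. x \<sqsubset> m" "\<forall>x \<in> set F2. \<not> x \<sqsubset> m"
    using increasing_split_at EF sorted_wrt_append by metis
  have F2: "\<forall>x \<in> set F2. m \<sqsubset> x"
  proof
    fix x assume "x \<in> set F2"
    moreover from this have "x \<noteq> m" using assms(1) xs A split by auto
    ultimately show "m \<sqsubset> x" using total split by blast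
  qed
  have "stack_map \<sigma> xs = stack_run \<sigma> ?X (m # I) (out2 @ T)"
    unfolding stack_map_def xs A using 1 2 3 4 by simp
  also have "\<dots> = (out2 @ T) @ rev (E @ F) @ rev D @ m # I"
    using stack_run_valley[OF D EF mI DmI] by simp
  \<comment> \<open>The new blocks, in the order of \<open>valley_below\<close>, are
    \<open>out2 @ T @ rev F2\<close>, \<open>rev (E @ F1)\<close>, \<open>rev D @ [m]\<close> and
    \<open>I\<close>. The guaranteed gain is \<open>m\<close>.\<close>
  finally have "stack_map \<sigma> xs = (out2 @ T @ rev F2) @ rev (E @ F1) @ (rev D @ [m]) @ I"
    using split by simp
  moreover have "decreasing (rev (E @ F1))"
    using EF split unfolding sorted_wrt_rev by (auto simp: sorted_wrt_append)
  moreover have "increasing ((rev D @ [m]) @ I)"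
    using D mI DmI by (auto simp: sorted_wrt_append sorted_wrt_rev)
  moreover have "\<forall>x \<in> set (rev (E @ F1) @ rev D @ [m]). \<forall>a \<in> set (out2 @ T @ rev F2). x \<sqsubset> a"
  proof (intro ballI)
    fix x a assume "x \<in> set (rev (E @ F1) @ rev D @ [m])" "a \<in> set (out2 @ T @ rev F2)"
    then have "x = m \<or> x \<sqsubset> m" "m \<sqsubset> a" using below A split out2 F2 by auto
    then show "x \<sqsubset> a" using trans by blast
  qed
  moreover have "Suc k \<le> length (rev (E @ F1) @ rev D @ [m])" using k by simp
  ultimately show ?thesis unfolding valley_below_def by blast
qed

section \<open>Iterates, periodic points and periods\<close>

lemma valley_funpow: "valley xs \<Longrightarrow> valley ((stack_map \<sigma> ^^ k) xs)"
  by (induction k) (auto simp: stack_map_valley valley_rev)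

lemma funpow_in_Perms: "\<pi> \<in> Perms n \<Longrightarrow> (stack_map \<sigma> ^^ k) \<pi> \<in> Perms n"
  by (induction k) (simp_all add: stack_map_in_Perms[OF length_pattern] del: One_nat_def)

lemma valley_eventually:
  assumes "\<pi> \<in> Perms n"
  shows "valley ((stack_map \<sigma> ^^ (n - 1)) \<pi>)"
proof -
  \<comment> \<open>Growth is available only for lists that are not valleys, hence the disjunction;
    a valley, once reached, is merely reversed.\<close>
  have step: "valley ((stack_map \<sigma> ^^ k) \<pi>) \<or> valley_below k ((stack_map \<sigma> ^^ k) \<pi>)" for k
  proof (induction k)
    case (Suc k)
    show ?case
    proof (cases "valley ((stack_map \<sigma> ^^ k) \<pi>)")
      case True
      then show ?thesis using valley_rev stack_map_valley by simp
    next
      case False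
      then show ?thesis
        using Suc valley_below_stack_map permutations_of_setD(2)[OF funpow_in_Perms[OF assms]] by simp
    qed
  qed (simp add: valley_below_0)
  have "length ((stack_map \<sigma> ^^ (n - 1)) \<pi>) = n"
    using length_finite_permutations_of_set[OF funpow_in_Perms[OF assms]] by simp
  then show ?thesis using step[of "n - 1"] valley_if_valley_below[of "n - 1" "(stack_map \<sigma> ^^ (n - 1)) \<pi>"] by auto
qed

lemma stack_map_twice: "valley \<pi> \<Longrightarrow> (stack_map \<sigma> ^^ 2) \<pi> = \<pi>"
  by (simp add: numeral_2_eq_2 stack_map_valley valley_rev)

lemma periodic_iff_valley:
  assumes "\<pi> \<in> Perms n"
  shows "periodic_point (stack_map \<sigma>) \<pi> \<longleftrightarrow> valley \<pi>"
proof
  assume "periodic_point (stack_map \<sigma>) \<pi>"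
  then obtain t where t: "t \<ge> 1" "(stack_map \<sigma> ^^ t) \<pi> = \<pi>"
    unfolding periodic_point_def by blast
  have fixed: "(stack_map \<sigma> ^^ (j * t)) \<pi> = \<pi>" for j
    by (induction j) (simp_all add: funpow_add t)
  \<comment> \<open>The return to \<open>\<pi>\<close> after \<open>n * t\<close> passes includes
    \<open>n - 1\<close> passes that reach a valley; the remaining \<open>r\<close> passes preserve
    it.\<close>
  have "n - 1 \<le> n * t" using t(1) by (cases t) auto
  then obtain r where "n * t = r + (n - 1)" by (metis le_iff_add add.commute)
  then have "\<pi> = (stack_map \<sigma> ^^ r) ((stack_map \<sigma> ^^ (n - 1)) \<pi>)"
    using fixed[of n] by (simp add: funpow_add)
  then show "valley \<pi>" using valley_funpow[OF valley_eventually[OF assms]] by metis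
next
  assume "valley \<pi>"
  then show "periodic_point (stack_map \<sigma>) \<pi>"
    unfolding periodic_point_def using stack_map_twice by (intro exI[of _ 2]) simp
qed

lemma period_valley:
  assumes "\<pi> \<in> Perms n" "n \<ge> 2" "valley \<pi>"
  shows "period (stack_map \<sigma>) \<pi> = 2"
  unfolding period_def
proof (rule Least_equality)
  show "2 \<ge> (1::nat) \<and> (stack_map \<sigma> ^^ 2) \<pi> = \<pi>" using stack_map_twice assms by simp
next
  fix t :: nat assume t: "t \<ge> 1 \<and> (stack_map \<sigma> ^^ t) \<pi> = \<pi>"
  \<comment> \<open>Period one would make \<open>\<pi>\<close> its own reverse, so its first and
    last entries, distinct for \<open>n \<ge> 2\<close>, would coincide.\<close>
  have "rev \<pi> \<noteq> \<pi>"
  proof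
    assume eq: "rev \<pi> = \<pi>"
    have len: "length \<pi> = n" and dist: "distinct \<pi>"
      using assms(1) length_finite_permutations_of_set permutations_of_setD by force+
    have "rev \<pi> ! 0 = \<pi> ! (n - 1)" using len assms(2) by (simp add: rev_nth)
    then have "\<pi> ! 0 = \<pi> ! (n - 1)" using eq by simp
    then show False using nth_eq_iff_index_eq[OF dist, of 0 "n - 1"] len assms(2) by simp
  qed
  then have "t \<noteq> 1" using t stack_map_valley[OF assms(3)] by auto
  then show "2 \<le> t" using t by simp
qed

lemma valley_iff_avoids:
  assumes "\<pi> \<in> Perms n"
  shows "valley \<pi> \<longleftrightarrow> avoids_pattern \<pi> \<sigma> \<and> avoids_pattern \<pi> \<tau>"
  using valley_avoids valley_if_avoids permutations_of_setD(2)[OF assms] by blast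

end

section \<open>The two orders and the resulting theorem\<close>

interpretation s132: peak_pattern_stack "(<)" "[1,3,2]" "[2,3,1]"
  by unfold_locales
    (auto simp: avoids_pattern_def contains_pattern_def same_relative_order_def
      standardize_eq_132_iff[simplified] standardize_eq_231_iff[simplified])

interpretation s312: peak_pattern_stack "(>)" "[3,1,2]" "[2,1,3]"
  by unfold_locales
    (auto simp: avoids_pattern_def contains_pattern_def same_relative_order_def
      standardize_eq_312_iff[simplified] standardize_eq_213_iff[simplified])

theorem theorem7p1:
  fixes n :: nat
  assumes "n \<ge> 1"
  shows "{\<pi> \<in> Perms n. periodic_point (stack_map [1,3,2]) \<pi>} =
           {\<pi> \<in> Perms n. avoids_pattern \<pi> [1,3,2] \<and> avoids_pattern \<pi> [2,3,1]}
       \<and> {\<pi> \<in> Perms n. periodic_point (stack_map [3,1,2]) \<pi>} =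
           {\<pi> \<in> Perms n. avoids_pattern \<pi> [2,1,3] \<and> avoids_pattern \<pi> [3,1,2]}
       \<and> (n \<ge> 2 \<longrightarrow>
            (\<forall>\<pi> \<in> Perms n. periodic_point (stack_map [1,3,2]) \<pi> \<longrightarrow>
               period (stack_map [1,3,2]) \<pi> = 2) \<and>
            (\<forall>\<pi> \<in> Perms n. periodic_point (stack_map [3,1,2]) \<pi> \<longrightarrow>
               period (stack_map [3,1,2]) \<pi> = 2))
       \<and> (\<forall>\<pi> \<in> Perms n.
            avoids_pattern ((stack_map [1,3,2] ^^ (n - 1)) \<pi>) [1,3,2] \<and>
            avoids_pattern ((stack_map [1,3,2] ^^ (n - 1)) \<pi>) [2,3,1] \<and>
            avoids_pattern ((stack_map [3,1,2] ^^ (n - 1)) \<pi>) [2,1,3] \<and>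
            avoids_pattern ((stack_map [3,1,2] ^^ (n - 1)) \<pi>) [3,1,2])"
proof -
  note s132 = s132.periodic_iff_valley s132.valley_iff_avoids s132.period_valley
  note s312 = s312.periodic_iff_valley s312.valley_iff_avoids s312.period_valley
  show ?thesis
  proof (intro conjI impI ballI)
    show "{\<pi> \<in> Perms n. periodic_point (stack_map [1,3,2]) \<pi>} =
           {\<pi> \<in> Perms n. avoids_pattern \<pi> [1,3,2] \<and> avoids_pattern \<pi> [2,3,1]}"
      \<comment> \<open>Both sides are the set of valleys in \<open>Perms n\<close>.\<close>
      using s132(1,2) by blast
    show "{\<pi> \<in> Perms n. periodic_point (stack_map [3,1,2]) \<pi>} =
           {\<pi> \<in> Perms n. avoids_pattern \<pi> [2,1,3] \<and> avoids_pattern \<pi> [3,1,2]}"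
      using s312(1,2) by blast
  next
    fix \<pi> assume "\<pi> \<in> Perms n" "2 \<le> n"
    then show "periodic_point (stack_map [1,3,2]) \<pi> \<Longrightarrow> period (stack_map [1,3,2]) \<pi> = 2"
      and "periodic_point (stack_map [3,1,2]) \<pi> \<Longrightarrow> period (stack_map [3,1,2]) \<pi> = 2"
      using s132(1,3) s312(1,3) by blast+
  next
    fix \<pi> assume "\<pi> \<in> Perms n"
    then have "s132.valley ((stack_map [1,3,2] ^^ (n - 1)) \<pi>)"
      and "s312.valley ((stack_map [3,1,2] ^^ (n - 1)) \<pi>)"
      by (rule s132.valley_eventually, rule s312.valley_eventually)
    then show "avoids_pattern ((stack_map [1,3,2] ^^ (n - 1)) \<pi>) [1,3,2]"
      and "avoids_pattern ((stack_map [1,3,2] ^^ (n - 1)) \<pi>) [2,3,1]"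
      and "avoids_pattern ((stack_map [3,1,2] ^^ (n - 1)) \<pi>) [2,1,3]"
      and "avoids_pattern ((stack_map [3,1,2] ^^ (n - 1)) \<pi>) [3,1,2]"
      by (simp_all only: s132.valley_avoids s312.valley_avoids)
  qed
qed

end
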